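(* There exist $\tau_0\in\mathbb{R}$ and time-varying (i.e. both non-constant) coefficients $\alpha,k:[\tau_0,\infty)\to\mathbb{R}$, with $k(\tau)>0$ for all $\tau\ge\tau_0$, such that for every initial condition $\mathbf{x}_0=(x(\tau_0),x'(\tau_0))\in\mathbb{R}^2$ the solution of $$x''+\alpha(\tau)x'-k(\tau)x=0,\qquad \tau\in[\tau_0,\infty),$$ is bounded.
   Context: A prime denotes differentiation with respect to $\tau$. Write $\mathbf{x}=(x,x')\in\mathbb{R}^2$, with the Euclidean norm $\|\cdot\|$; a solution is bounded if $\sup_{\tau\ge\tau_0}\|\mathbf{x}(\tau)\|<\infty$. The function $\alpha$ is called the damping and $-k$ the stiffness; the equations considered have negative stiffness, i.e. $k>0$. The coefficients are required to be such that solutions exist and are unique for all initial conditions in $\mathbb{R}^2$ and all initial times. *)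

theory Defs
  imports "HOL-Analysis.Analysis"
begin

text \<open>
  Functions on a half-line \<open>{t0..}\<close> are represented by total functions on the reals of which
  only the values on \<open>{t0..}\<close> are used; derivatives are taken within \<open>{t0..}\<close>, hence
  one-sided at \<open>t0\<close>.

  A classical solution of \<open>x'' + \<alpha> x' - k x = 0\<close> on \<open>{t0..}\<close>. The second function \<open>v\<close>
  is the derivative of \<open>x\<close>, so that the state of the system is \<open>(x, v)\<close>.
\<close>

definition solves_from ::
    "(real \<Rightarrow> real) \<Rightarrow> (real \<Rightarrow> real) \<Rightarrow> real \<Rightarrow> (real \<Rightarrow> real) \<Rightarrow> (real \<Rightarrow> real) \<Rightarrow> bool" where
  "solves_from \<alpha> k t0 x v \<longleftrightarrow>
     (\<forall>\<tau>\<ge>t0. (x has_real_derivative v \<tau>) (at \<tau> within {t0..}) \<and>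
        (\<exists>a. (v has_real_derivative a) (at \<tau> within {t0..}) \<and>
             a + \<alpha> \<tau> * v \<tau> - k \<tau> * x \<tau> = 0))"

text \<open>
  Existence and uniqueness of the forward solution, for every initial time \<open>t0 \<ge> \<tau>0\<close> and
  every initial state. Uniqueness is up to equality on \<open>{t0..}\<close>.
\<close>

definition well_posed_from :: "(real \<Rightarrow> real) \<Rightarrow> (real \<Rightarrow> real) \<Rightarrow> real \<Rightarrow> bool" where
  "well_posed_from \<alpha> k \<tau>0 \<longleftrightarrow>
     (\<forall>t0\<ge>\<tau>0. \<forall>x0 :: real \<times> real.
        (\<exists>x v. solves_from \<alpha> k t0 x v \<and> (x t0, v t0) = x0) \<and>
        (\<forall>x v y w. solves_from \<alpha> k t0 x v \<and> (x t0, v t0) = x0 \<and>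
                   solves_from \<alpha> k t0 y w \<and> (y t0, w t0) = x0 \<longrightarrow>
                   (\<forall>\<tau>\<ge>t0. x \<tau> = y \<tau> \<and> v \<tau> = w \<tau>)))"

end

theory Submission
  imports Defs
begin

text \<open>
  The idea is to factor the differential operator. With \<open>D = d/d\<tau>\<close>, the equation
  \<open>(D - q) (D + 2) x = 0\<close> reads \<open>x'' + (2 - q) x' - 2 q x = 0\<close>, so its stiffness is negative
  as soon as \<open>q > 0\<close>. Put \<open>u = x' + 2 x\<close>. Then \<open>u' = q u\<close>, which keeps \<open>u\<close> bounded if \<open>q\<close> is
  integrable, and \<open>x' = - 2 x + u\<close> is a stable equation with a bounded forcing, so that \<open>x\<close> and
  \<open>x'\<close> are bounded too. Negative stiffness that fades quickly enough is thus compensated by damping near 2.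

  To have solutions in closed form, let \<open>q\<close> be the logarithmic derivative of the bounded
  positive function \<open>2 - exp (- \<tau>)\<close> on \<open>\<tau> \<ge> 0\<close>. Solving the two first-order equations in turn
  gives the general solution \<open>c (1 - exp (- \<tau>)) + d exp (- 2 \<tau>)\<close>
  (lemma \<open>solves_from_factored_iff\<close>). Boundedness is visible from this formula, and
  well-posedness holds because \<open>c\<close> and \<open>d\<close> can be recovered from the state at any one time.
\<close>

definition fading_rate :: "real \<Rightarrow> real" where
  "fading_rate \<tau> = exp (- \<tau>) / (2 - exp (- \<tau>))"

definition position :: "real \<Rightarrow> real \<Rightarrow> real \<Rightarrow> real" where
  "position c d \<tau> = c * (1 - exp (- \<tau>)) + d * exp (- 2 * \<tau>)"

definition velocity :: "real \<Rightarrow> real \<Rightarrow> real \<Rightarrow> real" where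
  "velocity c d \<tau> = c * exp (- \<tau>) - 2 * d * exp (- 2 * \<tau>)"

lemma two_minus_exp_pos:
  fixes \<tau> :: real
  assumes "\<tau> \<ge> 0"
  shows "2 - exp (- \<tau>) > 0"
proof -
  have "exp (- \<tau>) \<le> 1"
    using assms by simp
  then show ?thesis
    by linarith
qed

lemma fading_rate_pos: "\<tau> \<ge> 0 \<Longrightarrow> fading_rate \<tau> > 0"
  unfolding fading_rate_def by (intro divide_pos_pos two_minus_exp_pos) auto

lemma fading_rate_zero_neq_ln_two: "fading_rate 0 \<noteq> fading_rate (ln 2)"
  by (simp add: fading_rate_def exp_minus)

lemma velocity_plus_two_position:
  "velocity c d \<tau> + 2 * position c d \<tau> = c * (2 - exp (- \<tau>))"
  by (simp add: position_def velocity_def algebra_simps)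

lemma has_derivative_position:
  "(position c d has_real_derivative velocity c d \<tau>) (at \<tau> within S)"
  unfolding position_def [abs_def] velocity_def
  by (auto intro!: derivative_eq_intros)

text \<open>
  The derivative is left in this form to show the factorization: with \<open>u = v + 2 x\<close> it is
  \<open>q u - 2 v\<close>, that is, \<open>u' = q u\<close>.
\<close>

lemma has_derivative_velocity:
  assumes "\<tau> \<ge> 0"
  shows "(velocity c d has_real_derivative
           fading_rate \<tau> * (velocity c d \<tau> + 2 * position c d \<tau>) - 2 * velocity c d \<tau>)
         (at \<tau> within S)"
proof -
  have "fading_rate \<tau> * (velocity c d \<tau> + 2 * position c d \<tau>) = c * exp (- \<tau>)"
    using two_minus_exp_pos [OF assms]
    by (simp add: velocity_plus_two_position fading_rate_def)
  moreover have "(velocity c d has_real_derivative c * exp (- \<tau>) - 2 * velocity c d \<tau>)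
         (at \<tau> within S)"
    unfolding velocity_def [abs_def]
    by (auto intro!: derivative_eq_intros simp: algebra_simps)
  ultimately show ?thesis
    by simp
qed

text \<open>
  Every solution has this form because \<open>c\<close> and \<open>d\<close> are first integrals: the factors are undone one after
  the other, the first by the integrating factor \<open>1 / (2 - exp (- \<tau>))\<close> and the second by
  \<open>exp (2 \<tau>)\<close>.
\<close>

lemma solves_from_factored_iff:
  assumes "t0 \<ge> 0"
  shows "solves_from (\<lambda>\<tau>. 2 - fading_rate \<tau>) (\<lambda>\<tau>. 2 * fading_rate \<tau>) t0 x v \<longleftrightarrow>
         (\<exists>c d. \<forall>\<tau>\<ge>t0. x \<tau> = position c d \<tau> \<and> v \<tau> = velocity c d \<tau>)"
    (is "?solves \<longleftrightarrow> ?explicit")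
proof
  assume ?solves
  then have x: "(x has_real_derivative v \<tau>) (at \<tau> within {t0..})"
    and v: "(v has_real_derivative fading_rate \<tau> * (v \<tau> + 2 * x \<tau>) - 2 * v \<tau>)
              (at \<tau> within {t0..})" if \<tau>: "\<tau> \<ge> t0" for \<tau>
  proof -
    show "(x has_real_derivative v \<tau>) (at \<tau> within {t0..})"
      using \<open>?solves\<close> \<tau> unfolding solves_from_def by blast
    obtain a where a: "(v has_real_derivative a) (at \<tau> within {t0..})"
        "a + (2 - fading_rate \<tau>) * v \<tau> - 2 * fading_rate \<tau> * x \<tau> = 0"
      using \<open>?solves\<close> \<tau> unfolding solves_from_def by blast
    then have "a = fading_rate \<tau> * (v \<tau> + 2 * x \<tau>) - 2 * v \<tau>"
      by (simp add: algebra_simps)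
    with a show "(v has_real_derivative fading_rate \<tau> * (v \<tau> + 2 * x \<tau>) - 2 * v \<tau>)
              (at \<tau> within {t0..})"
      by simp
  qed
  have "((\<lambda>\<tau>. (v \<tau> + 2 * x \<tau>) / (2 - exp (- \<tau>))) has_real_derivative 0)
          (at \<tau> within {t0..})" if "\<tau> \<in> {t0..}" for \<tau>
  proof -
    have "\<tau> \<ge> t0" "2 - exp (- \<tau>) \<noteq> 0"
      using that assms two_minus_exp_pos [of \<tau>] by auto
    then have "((\<lambda>\<tau>. v \<tau> + 2 * x \<tau>) has_real_derivative fading_rate \<tau> * (v \<tau> + 2 * x \<tau>))
        (at \<tau> within {t0..})"
      by (auto intro!: derivative_eq_intros x v)
    moreover have "((\<lambda>\<tau>. 2 - exp (- \<tau>)) has_real_derivative fading_rate \<tau> * (2 - exp (- \<tau>)))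
        (at \<tau> within {t0..})"
      using \<open>2 - exp (- \<tau>) \<noteq> 0\<close>
      by (auto intro!: derivative_eq_intros simp: fading_rate_def)
    ultimately show ?thesis
      using DERIV_quotient \<open>2 - exp (- \<tau>) \<noteq> 0\<close> by fastforce
  qed
  then obtain c where "\<forall>\<tau>\<in>{t0..}. (v \<tau> + 2 * x \<tau>) / (2 - exp (- \<tau>)) = c"
    using has_field_derivative_zero_constant [OF convex_real_interval(1)] by blast
  then have c: "v \<tau> + 2 * x \<tau> = c * (2 - exp (- \<tau>))" if "\<tau> \<ge> t0" for \<tau>
  proof -
    have "(v \<tau> + 2 * x \<tau>) / (2 - exp (- \<tau>)) = c" "2 - exp (- \<tau>) > 0"
      using \<open>\<forall>\<tau>\<in>{t0..}. (v \<tau> + 2 * x \<tau>) / (2 - exp (- \<tau>)) = c\<close>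
        that assms two_minus_exp_pos [of \<tau>] by simp_all
    then show ?thesis
      by (simp add: divide_eq_eq)
  qed
  have "((\<lambda>\<tau>. (x \<tau> - c * (1 - exp (- \<tau>))) * exp (2 * \<tau>)) has_real_derivative 0)
          (at \<tau> within {t0..})" if "\<tau> \<in> {t0..}" for \<tau>
  proof -
    have "v \<tau> = c * (2 - exp (- \<tau>)) - 2 * x \<tau>"
      using c [of \<tau>] that by simp
    then show ?thesis
      using that by (auto intro!: derivative_eq_intros x) (simp add: algebra_simps)
  qed
  then obtain d where "\<forall>\<tau>\<in>{t0..}. (x \<tau> - c * (1 - exp (- \<tau>))) * exp (2 * \<tau>) = d"
    using has_field_derivative_zero_constant [OF convex_real_interval(1)] by blast
  then have "d = (x \<tau> - c * (1 - exp (- \<tau>))) * exp (2 * \<tau>)" if "\<tau> \<ge> t0" for \<tau>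
    using that by simp
  then have position: "x \<tau> = position c d \<tau>" if "\<tau> \<ge> t0" for \<tau>
    using that by (simp add: position_def exp_minus mult.assoc)
  have "v \<tau> = velocity c d \<tau>" if "\<tau> \<ge> t0" for \<tau>
    using c [OF that] position [OF that] velocity_plus_two_position [of c d \<tau>] by simp
  with position show ?explicit
    by blast
next
  assume ?explicit
  then obtain c d where x: "\<And>\<tau>. \<tau> \<ge> t0 \<Longrightarrow> x \<tau> = position c d \<tau>"
    and v: "\<And>\<tau>. \<tau> \<ge> t0 \<Longrightarrow> v \<tau> = velocity c d \<tau>"
    by blast
  show ?solves
    unfolding solves_from_def
  proof (intro allI impI conjI exI)
    fix \<tau>
    assume "\<tau> \<ge> t0"
    have "(x has_real_derivative velocity c d \<tau>) (at \<tau> within {t0..})"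
      by (rule has_field_derivative_transform_within [OF has_derivative_position zero_less_one])
        (use x \<open>\<tau> \<ge> t0\<close> in auto)
    then show "(x has_real_derivative v \<tau>) (at \<tau> within {t0..})"
      using v \<open>\<tau> \<ge> t0\<close> by simp
    have "(v has_real_derivative
            fading_rate \<tau> * (velocity c d \<tau> + 2 * position c d \<tau>) - 2 * velocity c d \<tau>)
          (at \<tau> within {t0..})"
      by (rule has_field_derivative_transform_within [OF has_derivative_velocity zero_less_one])
        (use v \<open>\<tau> \<ge> t0\<close> assms in auto)
    then show "(v has_real_derivative fading_rate \<tau> * (v \<tau> + 2 * x \<tau>) - 2 * v \<tau>)
            (at \<tau> within {t0..})"
      using x v \<open>\<tau> \<ge> t0\<close> by simp
    show "fading_rate \<tau> * (v \<tau> + 2 * x \<tau>) - 2 * v \<tau> + (2 - fading_rate \<tau>) * v \<tau>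
            - 2 * fading_rate \<tau> * x \<tau> = 0"
      by (simp add: algebra_simps)
  qed
qed

lemma ex_position_velocity:
  assumes "t0 \<ge> 0"
  shows "\<exists>c d. position c d t0 = a \<and> velocity c d t0 = b"
proof -
  define c where "c = (b + 2 * a) / (2 - exp (- t0))"
  define d where "d = (a - c * (1 - exp (- t0))) * exp (2 * t0)"
  have "position c d t0 = a"
    by (simp add: position_def d_def exp_minus mult.assoc)
  moreover have "velocity c d t0 + 2 * position c d t0 = b + 2 * a"
    using two_minus_exp_pos [OF assms] by (simp add: velocity_plus_two_position c_def)
  ultimately show ?thesis
    by auto
qed

lemma position_velocity_inject:
  assumes "t0 \<ge> 0"
    and "position c d t0 = position c' d' t0" "velocity c d t0 = velocity c' d' t0"
  shows "c = c' \<and> d = d'"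
proof -
  have "c * (2 - exp (- t0)) = c' * (2 - exp (- t0))"
    using assms(2,3) by (metis velocity_plus_two_position)
  then have "c = c'"
    using two_minus_exp_pos [OF assms(1)] by simp
  with assms(2) show ?thesis
    by (simp add: position_def)
qed

lemma well_posed_from_factored:
  "well_posed_from (\<lambda>\<tau>. 2 - fading_rate \<tau>) (\<lambda>\<tau>. 2 * fading_rate \<tau>) 0"
  unfolding well_posed_from_def
proof (intro allI impI conjI)
  fix t0 :: real and x0 :: "real \<times> real"
  assume t0: "0 \<le> t0"
  obtain c d where "position c d t0 = fst x0" "velocity c d t0 = snd x0"
    using ex_position_velocity [OF t0] by blast
  moreover have "solves_from (\<lambda>\<tau>. 2 - fading_rate \<tau>) (\<lambda>\<tau>. 2 * fading_rate \<tau>) t0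
      (position c d) (velocity c d)"
    using solves_from_factored_iff [OF t0] by blast
  ultimately show "\<exists>x v. solves_from (\<lambda>\<tau>. 2 - fading_rate \<tau>) (\<lambda>\<tau>. 2 * fading_rate \<tau>) t0 x v
      \<and> (x t0, v t0) = x0"
    by (intro exI [of _ "position c d"] exI [of _ "velocity c d"]) simp
next
  fix t0 \<tau> :: real and x0 :: "real \<times> real" and x v y w :: "real \<Rightarrow> real"
  assume t0: "0 \<le> t0" and \<tau>: "t0 \<le> \<tau>"
    and sol: "solves_from (\<lambda>\<tau>. 2 - fading_rate \<tau>) (\<lambda>\<tau>. 2 * fading_rate \<tau>) t0 x v
          \<and> (x t0, v t0) = x0
          \<and> solves_from (\<lambda>\<tau>. 2 - fading_rate \<tau>) (\<lambda>\<tau>. 2 * fading_rate \<tau>) t0 y w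
          \<and> (y t0, w t0) = x0"
  obtain c d where xv: "\<And>\<tau>. \<tau> \<ge> t0 \<Longrightarrow> x \<tau> = position c d \<tau> \<and> v \<tau> = velocity c d \<tau>"
    using sol solves_from_factored_iff [OF t0] by blast
  obtain c' d' where yw: "\<And>\<tau>. \<tau> \<ge> t0 \<Longrightarrow> y \<tau> = position c' d' \<tau> \<and> w \<tau> = velocity c' d' \<tau>"
    using sol solves_from_factored_iff [OF t0] by blast
  have "x t0 = y t0" "v t0 = w t0"
    using sol by auto
  then have "c = c' \<and> d = d'"
    using xv [of t0] yw [of t0] by (intro position_velocity_inject [OF t0]) simp_all
  then show "x \<tau> = y \<tau>" "v \<tau> = w \<tau>"
    using xv [OF \<tau>] yw [OF \<tau>] by simp_all
qed

lemma bounded_position_velocity: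
  "bounded ((\<lambda>\<tau>. (position c d \<tau>, velocity c d \<tau>)) ` {0..})"
proof (rule bounded_subset)
  show "bounded (cball 0 (\<bar>c\<bar> + \<bar>d\<bar>) \<times> cball 0 (\<bar>c\<bar> + 2 * \<bar>d\<bar>) :: (real \<times> real) set)"
    by (intro bounded_Times bounded_cball)
  show "(\<lambda>\<tau>. (position c d \<tau>, velocity c d \<tau>)) ` {0..}
          \<subseteq> cball 0 (\<bar>c\<bar> + \<bar>d\<bar>) \<times> cball 0 (\<bar>c\<bar> + 2 * \<bar>d\<bar>)"
  proof clarsimp
    fix \<tau> :: real
    assume "0 \<le> \<tau>"
    have scale: "\<bar>a * r\<bar> \<le> \<bar>a\<bar>" if "0 \<le> r" "r \<le> 1" for a r :: real
      using that by (simp add: abs_mult mult_left_le)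
    have "\<bar>c * (1 - exp (- \<tau>))\<bar> \<le> \<bar>c\<bar>" "\<bar>c * exp (- \<tau>)\<bar> \<le> \<bar>c\<bar>"
      "\<bar>d * exp (- 2 * \<tau>)\<bar> \<le> \<bar>d\<bar>"
      using \<open>0 \<le> \<tau>\<close> by (intro scale; simp)+
    then show "\<bar>position c d \<tau>\<bar> \<le> \<bar>c\<bar> + \<bar>d\<bar> \<and> \<bar>velocity c d \<tau>\<bar> \<le> \<bar>c\<bar> + 2 * \<bar>d\<bar>"
      unfolding position_def velocity_def by linarith
  qed
qed

theorem corollary3p1:
  "\<exists>(\<tau>0 :: real) (\<alpha> :: real \<Rightarrow> real) (k :: real \<Rightarrow> real).
     \<not> \<alpha> constant_on {\<tau>0..} \<and> \<not> k constant_on {\<tau>0..} \<and>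
     (\<forall>\<tau>\<ge>\<tau>0. k \<tau> > 0) \<and>
     well_posed_from \<alpha> k \<tau>0 \<and>
     (\<forall>x0 :: real \<times> real. \<forall>x v.
        solves_from \<alpha> k \<tau>0 x v \<and> (x \<tau>0, v \<tau>0) = x0 \<longrightarrow>
        bounded ((\<lambda>\<tau>. (x \<tau>, v \<tau>)) ` {\<tau>0..}))"
proof (intro exI conjI allI impI)
  have const: "f 0 = f (ln 2)" if "f constant_on {0..}" for f :: "real \<Rightarrow> real"
    using that unfolding constant_on_def by force
  show "\<not> (\<lambda>\<tau>. 2 - fading_rate \<tau>) constant_on {0..}"
    using const [of "\<lambda>\<tau>. 2 - fading_rate \<tau>"] fading_rate_zero_neq_ln_two by auto
  show "\<not> (\<lambda>\<tau>. 2 * fading_rate \<tau>) constant_on {0..}"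
    using const [of "\<lambda>\<tau>. 2 * fading_rate \<tau>"] fading_rate_zero_neq_ln_two by auto
  show "2 * fading_rate \<tau> > 0" if "\<tau> \<ge> 0" for \<tau>
    using fading_rate_pos [OF that] by simp
  show "well_posed_from (\<lambda>\<tau>. 2 - fading_rate \<tau>) (\<lambda>\<tau>. 2 * fading_rate \<tau>) 0"
    by (rule well_posed_from_factored)
  fix x0 :: "real \<times> real" and x v
  assume "solves_from (\<lambda>\<tau>. 2 - fading_rate \<tau>) (\<lambda>\<tau>. 2 * fading_rate \<tau>) 0 x v
          \<and> (x 0, v 0) = x0"
  then obtain c d where "\<And>\<tau>. \<tau> \<ge> 0 \<Longrightarrow> x \<tau> = position c d \<tau> \<and> v \<tau> = velocity c d \<tau>"
    using solves_from_factored_iff [of 0 x v] by auto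
  then have "(\<lambda>\<tau>. (x \<tau>, v \<tau>)) ` {0..} = (\<lambda>\<tau>. (position c d \<tau>, velocity c d \<tau>)) ` {0..}"
    by (intro image_cong) auto
  then show "bounded ((\<lambda>\<tau>. (x \<tau>, v \<tau>)) ` {0..})"
    using bounded_position_velocity by simp
qed

end
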